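(* Let $E$ be the renewal shift graph: $E^0=\{u_k:k\ge1\}$, $E^1=\{e_k:k\ge1\}$, where for every $k\ge1$ one has $s(e_{2k})=u_{k+1}$, $r(e_{2k})=u_k$, and $s(e_{2k-1})=u_1$, $r(e_{2k-1})=u_{k+1}$. Then the Deaconu-Renault system $(X,\sigma)$ associated with $E$ does not have the shadowing property.
   Context: $\mathbb N=\{1,2,\ldots\}$. Graphs. A graph is $E=(E^0,E^1,r,s)$ with $E^0,E^1$ countable and $r,s:E^1\to E^0$. A finite path is a vertex (length $0$) or a sequence of edges $\alpha=\alpha_1\ldots\alpha_k$ with $r(\alpha_i)=s(\alpha_{i+1})$ for $1\le i<k$ (length $|\alpha|=k$); $\mathfrak p$ is the set of finite paths, including vertices, and $\mathfrak p^\infty$ the set of infinite paths $\gamma_1\gamma_2\ldots$ (with $r(\gamma_i)=s(\gamma_{i+1})$). One sets $r(v)=s(v)=v$ for vertices, $r(\alpha)=r(\alpha_{|\alpha|})$, $s(\alpha)=s(\alpha_1)$, $s(\gamma)\gamma=\gamma$, and $\gamma r(\gamma)=\gamma$ for finite $\gamma$. A finite path $\gamma$ is an initial segment of a path $\beta$ if $\beta=\gamma\gamma'$ for some path $\gamma'$ (so $s(\beta)$ is an initial segment of $\beta$). A vertex $v$ is an infinite emitter if $s^{-1}(v)$ is infinite. The associated system. $X=\mathfrak p^\infty\cup X_{fin}$, where $X_{fin}=\{\alpha\in\mathfrak p: r(\alpha)\text{ is an infinite emitter}\}$. The map $\sigma$ has domain $\mathrm{Dom}(\sigma)=\{x\in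 X:|x|\ge1\}$ and deletes the first edge: $\sigma(\gamma_1\gamma_2\ldots)=\gamma_2\gamma_3\ldots$, $\sigma(\gamma_1\ldots\gamma_n)=\gamma_2\ldots\gamma_n$ for $n\ge2$, $\sigma(\gamma_1)=r(\gamma_1)$. Metric. With $E^1=\{e_1,e_2,\ldots\}$, fix an edge ordered enumeration $\mathfrak p=\{p_1,p_2,\ldots\}$, i.e. one such that for every $e_i$ the source of $e_i$ and all paths of length less than $i$ formed by edges $e_k$ with $k<i$ appear before $e_i$. For $x\ne y$ in $X$, $d(x,y)=1/2^i$ where $i$ is the smallest value such that $p_i$ is an initial segment of one of $x,y$ but not of the other; $d(x,x)=0$. Shadowing. A $\delta$-chain is an infinite sequence $(x_i)_{i=1}^\infty$ in $\mathrm{Dom}(\sigma)$ with $d(\sigma(x_i),x_{i+1})<\delta$ for all $i$. A point $x\in X$ $\varepsilon$-shadows $(y_i)_{i=1}^\infty$ if, for all $i$, $\sigma^{i-1}(x)$ is defined and $d(\sigma^{i-1}(x),y_i)<\varepsilon$. $(X,\sigma)$ has the shadowing property if for every $\varepsilon>0$ there is $\delta>0$ such that every $\delta$-chain is $\varepsilon$-shadowed by some $x\in X$. *)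

theory Defs
  imports Complex_Main "HOL-Library.Stream" "HOL-Library.Extended_Nat" "Graph_Theory.Digraph"
begin

text \<open>
  Graphs are the directed multigraphs of \<^typ>\<open>('v, 'e) pre_digraph\<close>: the vertex set is
  \<^term>\<open>verts E\<close>, the edge set is \<^term>\<open>arcs E\<close>, the source map is
  \<^term>\<open>tail E\<close> and the range map is \<^term>\<open>head E\<close>.
  Paths, points of a sequence, edges and finite paths are all enumerated from 1.
\<close>

text \<open>Terms of this type are raw; they only denote paths if they lie in \<open>fin_paths E\<close> or
  \<open>inf_paths E\<close> below.  In particular the list of edges of a path is nonempty.\<close>

datatype ('v, 'e) path = Vertex 'v | Edges "'e list" | Infinite "'e stream"

definition fin_paths :: "('v, 'e) pre_digraph \<Rightarrow> ('v, 'e) path set" where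
  "fin_paths E = Vertex ` verts E \<union>
     {Edges as | as. as \<noteq> [] \<and> set as \<subseteq> arcs E \<and>
        (\<forall>i. Suc i < length as \<longrightarrow> head E (as ! i) = tail E (as ! Suc i))}"

definition inf_paths :: "('v, 'e) pre_digraph \<Rightarrow> ('v, 'e) path set" where
  "inf_paths E = {Infinite w | w. sset w \<subseteq> arcs E \<and>
     (\<forall>i. head E (w !! i) = tail E (w !! Suc i))}"

fun path_length :: "('v, 'e) path \<Rightarrow> enat" where
  "path_length (Vertex v) = 0"
| "path_length (Edges as) = enat (length as)"
| "path_length (Infinite w) = \<infinity>"

fun path_source :: "('v, 'e) pre_digraph \<Rightarrow> ('v, 'e) path \<Rightarrow> 'v" where
  "path_source E (Vertex v) = v"
| "path_source E (Edges as) = tail E (hd as)"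
| "path_source E (Infinite w) = tail E (shd w)"

text \<open>The range is left unspecified on infinite paths.\<close>

fun path_range :: "('v, 'e) pre_digraph \<Rightarrow> ('v, 'e) path \<Rightarrow> 'v" where
  "path_range E (Vertex v) = v"
| "path_range E (Edges as) = head E (last as)"

text \<open>Concatenation, meaningful if the first path is finite and its range is the source
  of the second one.\<close>

fun path_append :: "('v, 'e) path \<Rightarrow> ('v, 'e) path \<Rightarrow> ('v, 'e) path" where
  "path_append (Vertex v) q = q"
| "path_append (Edges as) (Vertex v) = Edges as"
| "path_append (Edges as) (Edges bs) = Edges (as @ bs)"
| "path_append (Edges as) (Infinite w) = Infinite (as @- w)"

definition initial_segment ::
    "('v, 'e) pre_digraph \<Rightarrow> ('v, 'e) path \<Rightarrow> ('v, 'e) path \<Rightarrow> bool" where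
  "initial_segment E p q \<longleftrightarrow> p \<in> fin_paths E \<and>
     (\<exists>q' \<in> fin_paths E \<union> inf_paths E. path_range E p = path_source E q' \<and> q = path_append p q')"

definition infinite_emitter :: "('v, 'e) pre_digraph \<Rightarrow> 'v \<Rightarrow> bool" where
  "infinite_emitter E v \<longleftrightarrow> v \<in> verts E \<and> infinite {a \<in> arcs E. tail E a = v}"

definition path_space :: "('v, 'e) pre_digraph \<Rightarrow> ('v, 'e) path set" where
  "path_space E = inf_paths E \<union> {p \<in> fin_paths E. infinite_emitter E (path_range E p)}"

definition shift_dom :: "('v, 'e) pre_digraph \<Rightarrow> ('v, 'e) path set" where
  "shift_dom E = {x \<in> path_space E. 1 \<le> path_length x}"

text \<open>The shift is left unspecified on paths of length 0.\<close>

fun shift_map :: "('v, 'e) pre_digraph \<Rightarrow> ('v, 'e) path \<Rightarrow> ('v, 'e) path" where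
  "shift_map E (Edges [a]) = Vertex (head E a)"
| "shift_map E (Edges (a # b # bs)) = Edges (b # bs)"
| "shift_map E (Infinite w) = Infinite (stl w)"

text \<open>An edge ordered enumeration \<open>p\<close> of the finite paths, relative to the enumeration \<open>e\<close>
  of the edges.  Paths formed by edges have positive length: otherwise all vertices would
  have to precede every edge, which is impossible if there are infinitely many of them.\<close>

definition edge_ordered_enumeration ::
    "('v, 'e) pre_digraph \<Rightarrow> (nat \<Rightarrow> 'e) \<Rightarrow> (nat \<Rightarrow> ('v, 'e) path) \<Rightarrow> bool" where
  "edge_ordered_enumeration E e p \<longleftrightarrow>
     bij_betw e {1..} (arcs E) \<and> bij_betw p {1..} (fin_paths E) \<and>
     (\<forall>i\<ge>1. \<forall>m\<ge>1. p m = Edges [e i] \<longrightarrow>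
        (\<exists>n\<in>{1..<m}. p n = Vertex (tail E (e i))) \<and>
        (\<forall>as. Edges as \<in> fin_paths E \<and> length as < i \<and> set as \<subseteq> e ` {1..<i} \<longrightarrow>
           (\<exists>n\<in>{1..<m}. p n = Edges as)))"

definition path_dist ::
    "('v, 'e) pre_digraph \<Rightarrow> (nat \<Rightarrow> ('v, 'e) path) \<Rightarrow> ('v, 'e) path \<Rightarrow> ('v, 'e) path \<Rightarrow> real" where
  "path_dist E p x y =
     (if x = y then 0
      else 1 / 2 ^ (LEAST i. 1 \<le> i \<and> initial_segment E (p i) x \<noteq> initial_segment E (p i) y))"

definition delta_chain ::
    "('v, 'e) pre_digraph \<Rightarrow> (nat \<Rightarrow> ('v, 'e) path) \<Rightarrow> real \<Rightarrow> (nat \<Rightarrow> ('v, 'e) path) \<Rightarrow> bool" where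
  "delta_chain E p \<delta> x \<longleftrightarrow>
     (\<forall>i\<ge>1. x i \<in> shift_dom E \<and> path_dist E p (shift_map E (x i)) (x (i + 1)) < \<delta>)"

definition shift_pow_defined :: "('v, 'e) pre_digraph \<Rightarrow> nat \<Rightarrow> ('v, 'e) path \<Rightarrow> bool" where
  "shift_pow_defined E n x \<longleftrightarrow> (\<forall>j<n. (shift_map E ^^ j) x \<in> shift_dom E)"

definition eps_shadows ::
    "('v, 'e) pre_digraph \<Rightarrow> (nat \<Rightarrow> ('v, 'e) path) \<Rightarrow> real \<Rightarrow>
      ('v, 'e) path \<Rightarrow> (nat \<Rightarrow> ('v, 'e) path) \<Rightarrow> bool" where
  "eps_shadows E p \<epsilon> x y \<longleftrightarrow>
     (\<forall>i\<ge>1. shift_pow_defined E (i - 1) x \<and>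
        path_dist E p ((shift_map E ^^ (i - 1)) x) (y i) < \<epsilon>)"

definition shadowing_property ::
    "('v, 'e) pre_digraph \<Rightarrow> (nat \<Rightarrow> ('v, 'e) path) \<Rightarrow> bool" where
  "shadowing_property E p \<longleftrightarrow>
     (\<forall>\<epsilon>>0. \<exists>\<delta>>0. \<forall>y. delta_chain E p \<delta> y \<longrightarrow> (\<exists>x\<in>path_space E. eps_shadows E p \<epsilon> x y))"

end

theory Submission
  imports Defs
begin

text \<open>Every path starting at \<open>u (n + 1)\<close> passes through \<open>u 1\<close> after \<open>n\<close> shifts, whereas
  paths starting at \<open>u K\<close> and at \<open>u (K + 1)\<close> are arbitrarily close for large \<open>K\<close>, since none of
  the first finite paths of the enumeration is an initial segment of either.  Hence the constant
  sequence given by the path from \<open>u (K + 1)\<close> down to \<open>u 1\<close> is a \<open>\<delta>\<close>-chain that never starts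
  at \<open>u 1\<close>, and no point shadows it closely enough to see this.\<close>

lemma initial_segment_source_eq:
  assumes "initial_segment E q x"
  shows "path_source E q = path_source E x"
proof -
  obtain q' where q: "q \<in> fin_paths E" and r: "path_range E q = path_source E q'"
    and x: "x = path_append q q'"
    using assms by (auto simp: initial_segment_def)
  show ?thesis
  proof (cases q)
    case (Vertex v)
    then show ?thesis using r x by simp
  next
    case (Edges as)
    then have "as \<noteq> []" using q by (auto simp: fin_paths_def)
    then show ?thesis using Edges x by (cases q') auto
  next
    case (Infinite w)
    then show ?thesis using q by (auto simp: fin_paths_def)
  qed
qed

text \<open>Vertices have length 0, so for the converse the complementary path is \<open>x\<close>
  itself. This is how the metric detects the source of a point.\<close>

lemma initial_segment_Vertex_iff:
  assumes "x \<in> path_space E" "v \<in> verts E"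
  shows "initial_segment E (Vertex v) x \<longleftrightarrow> path_source E x = v"
proof
  assume "initial_segment E (Vertex v) x"
  then show "path_source E x = v"
    using initial_segment_source_eq by fastforce
next
  assume "path_source E x = v"
  then show "initial_segment E (Vertex v) x"
    using assms by (auto simp: initial_segment_def path_space_def fin_paths_def intro!: bexI[of _ x])
qed

text \<open>If \<open>p m\<close> separated the points, the least separating index would be at most
  \<open>m\<close> and the distance at least \<open>1 / 2 ^ m\<close>.\<close>

lemma path_dist_less_imp_initial_segment_iff:
  assumes "path_dist E p x y < 1 / 2 ^ m" "1 \<le> m"
  shows "initial_segment E (p m) x \<longleftrightarrow> initial_segment E (p m) y"
proof (rule ccontr)
  assume ne: "\<not> ?thesis"
  define l where "l = (LEAST i. 1 \<le> i \<and> initial_segment E (p i) x \<noteq> initial_segment E (p i) y)"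
  have "l \<le> m"
    unfolding l_def using ne \<open>1 \<le> m\<close> by (intro Least_le) auto
  then have "1 / 2 ^ m \<le> (1 / 2 ^ l :: real)"
    by (simp add: frac_le)
  moreover have "path_dist E p x y = 1 / 2 ^ l"
    using ne by (auto simp: path_dist_def l_def)
  ultimately show False using assms by simp
qed

text \<open>The separating index \<open>m\<close> ensures that the \<open>LEAST\<close> in the
  distance is attained; agreement up to \<open>N\<close> then pushes it beyond
  \<open>N\<close>.\<close>

lemma path_dist_less:
  assumes "\<And>i. 1 \<le> i \<Longrightarrow> i \<le> N \<Longrightarrow> initial_segment E (p i) x \<longleftrightarrow> initial_segment E (p i) y"
    and "1 \<le> m" "initial_segment E (p m) x \<noteq> initial_segment E (p m) y"
  shows "path_dist E p x y < 1 / 2 ^ N"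
proof -
  define l where "l = (LEAST i. 1 \<le> i \<and> initial_segment E (p i) x \<noteq> initial_segment E (p i) y)"
  have "1 \<le> l \<and> initial_segment E (p l) x \<noteq> initial_segment E (p l) y"
    unfolding l_def by (rule LeastI[of _ m]) (use assms in auto)
  then have "N < l" using assms(1) by (meson not_le)
  then have "1 / 2 ^ l < (1 / 2 ^ N :: real)"
    by (simp add: frac_less2)
  moreover have "path_dist E p x y = 1 / 2 ^ l"
    using assms(3) by (auto simp: path_dist_def l_def)
  ultimately show ?thesis by simp
qed

text \<open>Reduces the effect of the shift on sources to one edge: the source moves along the first
  edge of the path, also when that edge is the whole path and the shift is a vertex.\<close>

lemma shift_dom_first_edge:
  assumes "x \<in> shift_dom E"
  obtains a where "a \<in> arcs E" "tail E a = path_source E x"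
    "path_source E (shift_map E x) = head E a"
proof (cases x)
  case (Vertex v)
  then show ?thesis using assms by (auto simp: shift_dom_def)
next
  case (Edges as)
  with assms obtain a bs where as: "as = a # bs" "set as \<subseteq> arcs E"
    and ch: "\<forall>i. Suc i < length as \<longrightarrow> head E (as ! i) = tail E (as ! Suc i)"
    by (cases as) (auto simp: shift_dom_def path_space_def fin_paths_def inf_paths_def)
  show ?thesis
  proof (rule that)
    show "path_source E (shift_map E x) = head E a"
      using Edges as spec[OF ch, of 0] by (cases bs) auto
  qed (use Edges as in auto)
next
  case (Infinite w)
  with assms have w: "sset w \<subseteq> arcs E" "\<forall>i. head E (w !! i) = tail E (w !! Suc i)"
    by (auto simp: shift_dom_def path_space_def inf_paths_def fin_paths_def)
  show ?thesis
  proof (rule that)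
    show "shd w \<in> arcs E" using w(1) shd_sset by blast
    show "path_source E (shift_map E x) = head E (shd w)"
      using Infinite spec[OF w(2), of 0] by simp
  qed (use Infinite in simp)
qed

theorem corollary5p12:
  fixes E :: "('v, 'e) pre_digraph"
    and u :: "nat \<Rightarrow> 'v" and e :: "nat \<Rightarrow> 'e"
    and p :: "nat \<Rightarrow> ('v, 'e) path"
  assumes "bij_betw u {1..} (verts E)"
    and "bij_betw e {1..} (arcs E)"
    and "\<And>k. k \<ge> 1 \<Longrightarrow> tail E (e (2 * k)) = u (k + 1)"
    and "\<And>k. k \<ge> 1 \<Longrightarrow> head E (e (2 * k)) = u k"
    and "\<And>k. k \<ge> 1 \<Longrightarrow> tail E (e (2 * k - 1)) = u 1"
    and "\<And>k. k \<ge> 1 \<Longrightarrow> head E (e (2 * k - 1)) = u (k + 1)"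
    and "edge_ordered_enumeration E e p"
  shows "\<not> shadowing_property E p"
proof
  assume shadowing: "shadowing_property E p"
  have u_inj: "u i = u j \<longleftrightarrow> i = j" if "1 \<le> i" "1 \<le> j" for i j
    using assms(1) that by (auto simp: bij_betw_def inj_on_def)
  have u_verts: "u i \<in> verts E" if "1 \<le> i" for i
    using assms(1) that by (auto simp: bij_betw_def)
  have e_arcs: "e i \<in> arcs E" if "1 \<le> i" for i
    using assms(2) that by (auto simp: bij_betw_def)
  have arcs_cases: "(\<exists>k\<ge>1. a = e (2 * k)) \<or> (\<exists>k\<ge>1. a = e (2 * k - 1))"
    if "a \<in> arcs E" for a
  proof -
    have "a \<in> e ` {1..}"
      using assms(2) that by (simp add: bij_betw_imp_surj_on)
    then obtain i where i: "1 \<le> i" "a = e i"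
      by auto
    show ?thesis
    proof (cases "even i")
      case True
      then obtain k where "i = 2 * k" by blast
      then show ?thesis using i by auto
    next
      case False
      then obtain k where "i = 2 * k + 1" by (elim oddE)
      then have "i = 2 * Suc k - 1" "1 \<le> Suc k" by auto
      then show ?thesis using i by blast
    qed
  qed
  \<comment> \<open>All odd edges leave from \<open>u 1\<close>, so \<open>e (2 * k)\<close> is the
    only edge leaving \<open>u (k + 1)\<close>, and a path starting there must descend to
    \<open>u k\<close>.\<close>
  have shift_source: "path_source E (shift_map E x) = u k"
    if x: "x \<in> shift_dom E" and src: "path_source E x = u (k + 1)" and k: "1 \<le> k" for x k
  proof -
    obtain a where a: "a \<in> arcs E" "tail E a = path_source E x"
      "path_source E (shift_map E x) = head E a"
      using x by (rule shift_dom_first_edge)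
    have "u (k + 1) \<noteq> u 1" using u_inj k by simp
    then obtain j where "1 \<le> j" "a = e (2 * j)"
      using arcs_cases[OF a(1)] a(2) src assms(5) by auto
    then show ?thesis using a src k assms(3,4) u_inj[of "k + 1" "j + 1"] by auto
  qed
  have visits_u1: "path_source E ((shift_map E ^^ n) x) = u 1"
    if "path_source E x = u (n + 1)" "\<And>j. (shift_map E ^^ j) x \<in> shift_dom E" for n x
    using that
  proof (induction n arbitrary: x)
    case (Suc n)
    have "path_source E (shift_map E x) = u (n + 1)"
      using shift_source[of x "n + 1"] Suc.prems(1) Suc.prems(2)[of 0] by simp
    moreover have "(shift_map E ^^ j) (shift_map E x) \<in> shift_dom E" for j
      using Suc.prems(2)[of "Suc j"] by (simp add: funpow_swap1)
    ultimately show ?case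
      using Suc.IH[of "shift_map E x"] by (simp add: funpow_swap1)
  qed simp
  have p_onto: "\<exists>i\<ge>1. p i = Vertex (u k)" if "1 \<le> k" for k
  proof -
    have "Vertex (u k) \<in> p ` {1..}"
      using assms(7) u_verts[OF that]
      by (auto simp: edge_ordered_enumeration_def bij_betw_def fin_paths_def)
    then show ?thesis by (auto simp: eq_commute)
  qed
  \<comment> \<open>Two points at distance less than \<open>1 / 2 ^ m\<close> either both start at
    \<open>u 1\<close> or both do not; this fixes the shadowing precision.\<close>
  obtain m where m: "1 \<le> m" "p m = Vertex (u 1)" using p_onto by blast
  obtain \<delta> where "\<delta> > 0" and \<delta>: "\<And>y. delta_chain E p \<delta> y \<Longrightarrow>
      \<exists>x\<in>path_space E. eps_shadows E p (1 / 2 ^ m) x y"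
    using shadowing[unfolded shadowing_property_def, rule_format, of "1 / 2 ^ m"] by auto
  obtain N where N: "1 / 2 ^ N < \<delta>"
    using real_arch_pow_inv[OF \<open>\<delta> > 0\<close>, of "1 / 2"] by (auto simp: power_one_over)
  \<comment> \<open>The first \<open>N\<close> paths have at most \<open>N\<close> sources and
    \<open>u\<close> is injective, so only finitely many indices \<open>k\<close> have to be
    avoided.\<close>
  obtain K where K: "2 \<le> K" "\<And>k i. K \<le> k \<Longrightarrow> 1 \<le> i \<Longrightarrow> i \<le> N \<Longrightarrow> path_source E (p i) \<noteq> u k"
  proof -
    let ?S = "{k \<in> {1..}. u k \<in> (\<lambda>i. path_source E (p i)) ` {1..N}}"
    have "inj_on u ?S"
      using u_inj by (auto simp: inj_on_def)
    moreover have "finite (u ` ?S)"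
      by (rule finite_subset[of _ "(\<lambda>i. path_source E (p i)) ` {1..N}"]) auto
    ultimately have "finite ?S" by (rule finite_imageD[rotated])
    then obtain B where B: "\<forall>k\<in>?S. k \<le> B"
      using finite_nat_set_iff_bounded_le by blast
    show thesis
    proof (rule that[of "B + 2"])
      show "path_source E (p i) \<noteq> u k" if "B + 2 \<le> k" "1 \<le> i" "i \<le> N" for k i
      proof
        assume "path_source E (p i) = u k"
        then have "k \<in> ?S" using that by (auto intro!: image_eqI[of _ _ i])
        then have "k \<le> B" by (rule bspec[OF B])
        then show False using that(1) by simp
      qed
    qed simp
  qed
  \<comment> \<open>The descending path with edges \<open>e (2 * k)\<close>, ...,
    \<open>e 4\<close>, \<open>e 2\<close>, from \<open>u (k + 1)\<close> to \<open>u 1\<close>.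
    Although finite, it is a point of the space because the odd edges make \<open>u 1\<close> an
    infinite emitter.\<close>
  define desc :: "nat \<Rightarrow> ('v, 'e) path"
    where "desc k = Edges (map (\<lambda>i. e (2 * i)) (rev [1..<Suc k]))" for k
  have "infinite_emitter E (u 1)"
  proof -
    have "inj_on (\<lambda>k. e (2 * k - 1)) {1..}"
    proof (rule inj_onI)
      fix i j :: nat assume ij: "i \<in> {1..}" "j \<in> {1..}" "e (2 * i - 1) = e (2 * j - 1)"
      then have "2 * i - 1 = 2 * j - 1"
        using assms(2) by (intro inj_onD[of e "{1..}"]) (auto simp: bij_betw_def)
      then show "i = j" using ij(1,2) by auto
    qed
    then have "infinite ((\<lambda>k. e (2 * k - 1)) ` {1..})"
      using finite_imageD infinite_Ici by blast
    moreover have "(\<lambda>k. e (2 * k - 1)) ` {1..} \<subseteq> {a \<in> arcs E. tail E a = u 1}"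
      using e_arcs assms(5) by auto
    ultimately show ?thesis
      using u_verts finite_subset by (auto simp: infinite_emitter_def)
  qed
  then have desc_dom: "desc k \<in> shift_dom E" if "1 \<le> k" for k
  proof -
    let ?as = "map (\<lambda>i. e (2 * i)) (rev [1..<Suc k])"
    have nth: "?as ! i = e (2 * (k - i))" if "i < k" for i
    proof -
      have "[1..<Suc k] ! (k - Suc i) = k - i"
        using nth_upt[of 1 "k - Suc i" "Suc k"] that by (simp del: upt_Suc)
      then show ?thesis using that by (simp add: rev_nth del: upt_Suc nth_upt)
    qed
    have "head E (?as ! i) = tail E (?as ! Suc i)" if "Suc i < k" for i
      unfolding nth[OF that] nth[OF Suc_lessD[OF that]]
      using that assms(3)[of "k - Suc i"] assms(4)[of "k - i"] by (simp add: Suc_diff_Suc)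
    moreover have "set ?as \<subseteq> arcs E" using e_arcs by auto
    moreover have "last ?as = e 2" using \<open>1 \<le> k\<close>
      by (simp add: last_map last_rev upt_conv_Cons del: upt_Suc)
    ultimately show ?thesis
      using \<open>1 \<le> k\<close> \<open>infinite_emitter E (u 1)\<close> assms(4)[of 1]
      by (auto simp: desc_def shift_dom_def path_space_def fin_paths_def one_enat_def simp del: upt_Suc)
  qed
  have desc_source: "path_source E (desc k) = u (k + 1)" if "1 \<le> k" for k
    using that assms(3) by (simp add: desc_def)
  have desc_shift: "shift_map E (desc (Suc k)) = desc k" if "1 \<le> k" for k
    using that by (cases k) (simp_all add: desc_def)
  \<comment> \<open>This point starts at \<open>u (K + 2)\<close> and its shift
    \<open>desc K\<close> at \<open>u (K + 1)\<close>. Neither vertex is the source of one of the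
    first \<open>N\<close> paths, so none of these is an initial segment of either point.\<close>
  let ?y = "desc (K + 1)"
  have "delta_chain E p \<delta> (\<lambda>_. ?y)"
  proof -
    \<comment> \<open>The separating index required by \<open>path_dist_less\<close>: this vertex is
      an initial segment of \<open>desc K\<close> only.\<close>
    obtain j where j: "1 \<le> j" "p j = Vertex (u (K + 1))" using p_onto[of "K + 1"] by auto
    have src: "path_source E (desc K) = u (K + 1)" "path_source E ?y = u (K + 2)"
      using desc_source K by auto
    have sp: "desc K \<in> path_space E" "?y \<in> path_space E"
      using desc_dom K by (auto simp: shift_dom_def)
    have "path_dist E p (desc K) ?y < 1 / 2 ^ N"
    proof (rule path_dist_less)
      show "initial_segment E (p i) (desc K) \<longleftrightarrow> initial_segment E (p i) ?y"
        if "1 \<le> i" "i \<le> N" for i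
        using initial_segment_source_eq K(2)[OF _ that] src by (metis le_add1)
      show "initial_segment E (p j) (desc K) \<noteq> initial_segment E (p j) ?y"
        using initial_segment_Vertex_iff[OF sp(1)] initial_segment_Vertex_iff[OF sp(2)]
          src u_verts u_inj[of "K + 1" "K + 2"] j by simp
    qed (fact j(1))
    then show ?thesis
      using N desc_dom desc_shift K(1) by (simp add: delta_chain_def)
  qed
  then obtain x where x: "eps_shadows E p (1 / 2 ^ m) x (\<lambda>_. ?y)" using \<delta> by blast
  \<comment> \<open>Shadowing at index \<open>j + 2\<close> says that \<open>j + 1\<close> shifts of
    \<open>x\<close> are defined, which puts the \<open>j\<close>-th iterate in the domain. So
    \<open>x\<close> can be shifted forever.\<close>
  have dom: "(shift_map E ^^ j) x \<in> shift_dom E" for j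
    using x[unfolded eps_shadows_def shift_pow_defined_def, rule_format, of "j + 2"] by simp
  have dist: "path_dist E p ((shift_map E ^^ j) x) ?y < 1 / 2 ^ m" for j
    using x[unfolded eps_shadows_def, rule_format, of "j + 1"] by simp
  \<comment> \<open>The first edge of \<open>x\<close> leaves from \<open>u 1\<close> or some
    \<open>u (k + 1)\<close>, which yields the number \<open>n\<close> of shifts leading to
    \<open>u 1\<close>; \<open>n = 0\<close> is allowed.\<close>
  obtain a where a: "a \<in> arcs E" "tail E a = path_source E x"
    using shift_dom_first_edge[of x E] dom[of 0] by auto
  then obtain n where n: "path_source E x = u (n + 1)"
    using arcs_cases[OF a(1)] assms(3,5) by (metis add_0)
  let ?z = "(shift_map E ^^ n) x"
  have "path_source E ?z = u 1" using visits_u1 n dom by blast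
  then have "initial_segment E (p m) ?z"
    using initial_segment_Vertex_iff[of ?z E "u 1"] dom[of n] u_verts m by (simp add: shift_dom_def)
  then have "initial_segment E (p m) ?y"
    using path_dist_less_imp_initial_segment_iff[OF dist m(1)] by blast
  then have "u 1 = u (K + 2)"
    using initial_segment_source_eq desc_source[of "K + 1"] m(2) by fastforce
  then show False using u_inj[of 1 "K + 2"] by simp
qed

end
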